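(* Let $k,n$ be positive integers, $m=kn$, and $a,b$ positive integers with $ma=nb$. For $t\in(0,\frac1m)$ let $\mathbf r(t)=(a-t,\dots,a-t)\in\mathbb R^m$ and $\mathbf c(t)=(b,\dots,b,b-mt)\in\mathbb R^n$. Then for every $t\in(0,\frac1m)$ the set of auxiliary graphs of vertices of $\mathcal T(\mathbf r(t),\mathbf c(t))$ equals $\mathrm{ST}_{k,n}$, the set of spanning trees of $K_{kn,n}$ with right degree sequence $(k+1,\dots,k+1,k)$; in particular the vertices of $\mathcal T(\mathbf r(t),\mathbf c(t))$ are in bijection with $\mathrm{ST}_{k,n}$. Moreover, for $T\in\mathrm{ST}_{k,n}$, regarded as a tree rooted at $w_n$, the corresponding vertex is the matrix $M_T(t)$ with \[ M_T(t)(i,j)=\begin{cases} a-l(T_{u_i})\,t & \text{if } w_j \text{ is the parent of } u_i \text{ in } T,\\ l(T_{w_j})\,t & \text{if } u_i \text{ is the parent of } w_j\text{ in }T,\\ 0&\text{otherwise.}\end{cases}\]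
   Context: $\mathcal T(\mathbf r,\mathbf c)$ is the set of nonnegative real $m\times n$ matrices with $i$th row sum $r_i$ and $j$th column sum $c_j$. $K_{m,n}$ is the complete bipartite graph with left vertices $u_1,\dots,u_m$, right vertices $w_1,\dots,w_n$, edges $e_{i,j}=\{u_i,w_j\}$. The auxiliary graph of a matrix $M$ is the spanning subgraph with edge set $\{e_{i,j}: M(i,j)>0\}$. The right degree sequence of a subgraph $G$ is $(d_1,\dots,d_n)$ with $d_j$ the number of edges of $G$ at $w_j$. For a tree $T$ rooted at $w_n$ and a vertex $v$, $T_v$ is the subtree of descendants of $v$ (rooted at $v$), and $l(G)$ is the number of left vertices $u_i$ in $G$. *)

theory Defs
  imports "HOL-Analysis.Analysis"
begin

text \<open>
  Finite undirected simple graphs, with edges as two-element vertex sets. The symmetric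
  digraphs of the AFP entry Graph_Theory are not suitable for trees: there \<open>a, b, a\<close> counts
  as a cycle.
\<close>

record 'v ugraph =
  gverts :: "'v set"
  gedges :: "'v set set"

definition gpath :: "'v ugraph \<Rightarrow> 'v list \<Rightarrow> bool" where
  "gpath G p \<longleftrightarrow> p \<noteq> [] \<and> distinct p \<and> set p \<subseteq> gverts G \<and>
     successively (\<lambda>u v. {u, v} \<in> gedges G) p"

definition gcycle :: "'v ugraph \<Rightarrow> 'v list \<Rightarrow> bool" where
  "gcycle G p \<longleftrightarrow> gpath G p \<and> 3 \<le> length p \<and> {last p, hd p} \<in> gedges G"

definition gconnected :: "'v ugraph \<Rightarrow> bool" where
  "gconnected G \<longleftrightarrow> gverts G \<noteq> {} \<and>
     (\<forall>u\<in>gverts G. \<forall>v\<in>gverts G. \<exists>p. gpath G p \<and> hd p = u \<and> last p = v)"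

definition gtree :: "'v ugraph \<Rightarrow> bool" where
  "gtree G \<longleftrightarrow> gconnected G \<and> \<not> (\<exists>p. gcycle G p)"

definition spanning_subgraph :: "'v ugraph \<Rightarrow> 'v ugraph \<Rightarrow> bool" where
  "spanning_subgraph H G \<longleftrightarrow> gverts H = gverts G \<and> gedges H \<subseteq> gedges G"

definition spanning_tree :: "'v ugraph \<Rightarrow> 'v ugraph \<Rightarrow> bool" where
  "spanning_tree T G \<longleftrightarrow> spanning_subgraph T G \<and> gtree T"

text \<open>
  In a tree \<open>T\<close> with root \<open>r\<close> there is exactly one path from each vertex to \<open>r\<close>. The parent of
  a vertex is the next vertex on this path, and the descendants of \<open>v\<close> (\<open>v\<close> included) are the
  vertices whose path to \<open>r\<close> passes through \<open>v\<close>.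
\<close>

definition is_parent :: "'v ugraph \<Rightarrow> 'v \<Rightarrow> 'v \<Rightarrow> 'v \<Rightarrow> bool" where
  \<comment> \<open>\<open>x\<close> is the parent of \<open>v\<close>\<close>
  "is_parent T r x v \<longleftrightarrow> (\<exists>p. gpath T (v # x # p) \<and> last (x # p) = r)"

definition descendants :: "'v ugraph \<Rightarrow> 'v \<Rightarrow> 'v \<Rightarrow> 'v set" where
  "descendants T r v = {x. \<exists>p. gpath T p \<and> hd p = x \<and> last p = r \<and> v \<in> set p}"

definition subtree :: "'v ugraph \<Rightarrow> 'v \<Rightarrow> 'v \<Rightarrow> 'v ugraph" where
  "subtree T r v =
     \<lparr>gverts = descendants T r v, gedges = {e \<in> gedges T. e \<subseteq> descendants T r v}\<rparr>"

text \<open>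
  The left vertices \<open>u\<^sub>i\<close> are \<open>Inl i\<close> for \<open>i :: 'm\<close> and the right vertices \<open>w\<^sub>j\<close> are \<open>Inr j\<close> for
  \<open>j :: 'n\<close>, so that \<open>m = CARD('m)\<close> and \<open>n = CARD('n)\<close>.
\<close>

definition complete_bipartite :: "('m + 'n) ugraph" where
  "complete_bipartite = \<lparr>gverts = UNIV, gedges = {{Inl i, Inr j} | i j. True}\<rparr>"

definition right_degree_sequence :: "('m + 'n) ugraph \<Rightarrow> 'n \<Rightarrow> nat" where
  "right_degree_sequence G = (\<lambda>j. card {e \<in> gedges G. Inr j \<in> e})"

definition left_count :: "('m + 'n) ugraph \<Rightarrow> nat" where
  "left_count G = card {i. Inl i \<in> gverts G}"

definition transportation_polytope ::
    "real ^ 'm \<Rightarrow> real ^ 'n \<Rightarrow> (real ^ 'n ^ 'm) set" where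
  "transportation_polytope r c =
     {M. (\<forall>i j. 0 \<le> M $ i $ j) \<and> (\<forall>i. (\<Sum>j\<in>UNIV. M $ i $ j) = r $ i) \<and>
         (\<forall>j. (\<Sum>i\<in>UNIV. M $ i $ j) = c $ j)}"

definition polytope_vertices :: "'a::real_vector set \<Rightarrow> 'a set" where
  "polytope_vertices P = {x. x extreme_point_of P}"

definition auxiliary_graph :: "real ^ 'n ^ 'm \<Rightarrow> ('m + 'n) ugraph" where
  "auxiliary_graph M =
     \<lparr>gverts = UNIV, gedges = {{Inl i, Inr j} | i j. M $ i $ j > 0}\<rparr>"

text \<open>
  In the definitions below, \<open>w :: 'n\<close> is the index of the distinguished right vertex \<open>w\<^sub>n\<close>:
  the last entry of \<open>c(t)\<close> and of the degree sequence is the one at \<open>w\<close>, and trees are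
  rooted at \<open>Inr w\<close>.
\<close>

definition ST :: "nat \<Rightarrow> 'n \<Rightarrow> ('m + 'n) ugraph set" where
  "ST k w = {T. spanning_tree T complete_bipartite \<and>
     right_degree_sequence T = (\<lambda>j. if j = w then k else k + 1)}"

definition row_sums :: "nat \<Rightarrow> real \<Rightarrow> real ^ 'm" where
  "row_sums a t = (\<chi> i. real a - t)"

definition col_sums :: "'n \<Rightarrow> nat \<Rightarrow> nat \<Rightarrow> real \<Rightarrow> real ^ 'n" where
  "col_sums w m b t = (\<chi> j. if j = w then real b - real m * t else real b)"

definition tree_matrix :: "'n \<Rightarrow> nat \<Rightarrow> real \<Rightarrow> ('m + 'n) ugraph \<Rightarrow> real ^ 'n ^ 'm" where
  "tree_matrix w a t T = (\<chi> i j.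
     if is_parent T (Inr w) (Inr j) (Inl i)
     then real a - real (left_count (subtree T (Inr w) (Inl i))) * t
     else if is_parent T (Inr w) (Inl i) (Inr j)
     then real (left_count (subtree T (Inr w) (Inr j))) * t
     else 0)"

end

theory Submission
  imports Defs
begin

text \<open>
  A point of a transportation polytope is a vertex iff its support carries no nonzero matrix
  with zero row and column sums. A cycle carries such a matrix (alternate the signs \<open>1\<close> and
  \<open>-1\<close>), a tree does not, and a vertex is determined by its support. For the perturbed
  margins, a connected component with row set \<open>I\<close> and column set \<open>J\<close> satisfies
  \<open>|I| a - |J| b = (|I| - [w \<in> J] m) t\<close>, where the left side is an integer and the right side is
  smaller than \<open>1\<close> in modulus; hence the graph is connected.

  In a tree with root \<open>w\<close> the entry at the edge from \<open>v\<close> to its parent is determined by the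
  subtree of \<open>v\<close>: with \<open>l\<close> left and \<open>r\<close> right vertices it is \<open>a (l - k r) - l t\<close> if \<open>v\<close> is a left
  vertex and \<open>a (k r - l) + l t\<close> if it is a right vertex, as \<open>b = k a\<close>. Positivity means
  \<open>l > k r\<close> or \<open>l \<le> k r\<close>, respectively, and adding up over the children of a right vertex leaves
  room for at most \<open>k\<close> of them. Since there are \<open>k n\<close> left vertices, each right vertex has exactly
  \<open>k\<close> children. Conversely, if each right vertex has \<open>k\<close> children, the matrix \<open>M\<^sub>T(t)\<close> has the
  required margins.
\<close>

section \<open>Paths in graphs\<close>

lemma gpath_suffix: "gpath G (p @ q) \<Longrightarrow> q \<noteq> [] \<Longrightarrow> gpath G q"
  by (auto simp: gpath_def successively_append_iff)

lemma gpath_prefix: "gpath G (p @ q) \<Longrightarrow> p \<noteq> [] \<Longrightarrow> gpath G p"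
  by (auto simp: gpath_def successively_append_iff)

lemma gpath_Cons:
  "gpath G p \<Longrightarrow> v \<notin> set p \<Longrightarrow> v \<in> gverts G \<Longrightarrow> {v, hd p} \<in> gedges G \<Longrightarrow> gpath G (v # p)"
  by (cases p) (auto simp: gpath_def)

lemma successively_rev_edges:
  "successively (\<lambda>u v. {u, v} \<in> E) (rev p) \<longleftrightarrow> successively (\<lambda>u v. {u, v} \<in> E) p"
  by (simp add: successively_rev insert_commute)

text \<open>Paths are simple here, so if \<open>x\<close> already lies on \<open>p\<close> the path
  is cut at \<open>x\<close> instead of being extended.\<close>

lemma gpath_extend:
  assumes "gpath G p" and "{last p, x} \<in> gedges G" and "x \<in> gverts G"
  shows "\<exists>q. gpath G q \<and> hd q = hd p \<and> last q = x"
proof (cases "x \<in> set p")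
  case True
  then obtain p1 p2 where p: "p = p1 @ x # p2"
    by (meson split_list)
  then have "gpath G (p1 @ [x])"
    using assms(1) gpath_prefix[of G "p1 @ [x]" p2] by simp
  moreover have "hd (p1 @ [x]) = hd p"
    using p by (cases p1) auto
  ultimately show ?thesis
    by (intro exI[of _ "p1 @ [x]"]) simp
next
  case False
  then have "gpath G (p @ [x])"
    using assms by (auto simp: gpath_def successively_append_iff)
  moreover have "hd (p @ [x]) = hd p"
    using assms(1) by (simp add: gpath_def)
  ultimately show ?thesis
    by (intro exI[of _ "p @ [x]"]) simp
qed

text \<open>Follow \<open>p\<close> up to its first vertex \<open>z\<close> on \<open>q\<close> and
  return to \<open>u\<close> along \<open>q\<close>. Taking the first such vertex keeps
  \<open>p1\<close> disjoint from \<open>q\<close>, so the closed walk repeats no vertex.\<close>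

lemma gcycle_of_diverging_paths:
  assumes p: "gpath G (u # p)" and q: "gpath G (u # q)"
    and ne: "p \<noteq> []" "q \<noteq> []" and last: "last p = last q" and hd: "hd p \<noteq> hd q"
  shows "\<exists>c. gcycle G c"
proof -
  have "\<exists>z\<in>set p. z \<in> set q"
    using ne last by (metis last_in_set)
  then obtain p1 z p2 where pz: "p = p1 @ z # p2" "z \<in> set q" "\<forall>x\<in>set p1. x \<notin> set q"
    using split_list_first_prop[of p "\<lambda>x. x \<in> set q"] by blast
  obtain q1 q2 where qz: "q = q1 @ z # q2"
    using pz(2) by (meson split_list)
  define c where "c = u # p1 @ z # rev q1"
  have dist: "distinct c"
    using p q pz qz by (auto simp: c_def gpath_def)
  have verts: "set c \<subseteq> gverts G"
    using p q pz qz by (auto simp: c_def gpath_def)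
  have p1: "successively (\<lambda>u v. {u, v} \<in> gedges G) ((u # p1) @ [z])"
    using p pz(1) successively_append_iff[of _ "(u # p1) @ [z]" p2] by (auto simp: gpath_def)
  have "successively (\<lambda>u v. {u, v} \<in> gedges G) ((u # q1) @ [z])"
    using q qz successively_append_iff[of _ "(u # q1) @ [z]" q2] by (auto simp: gpath_def)
  then have q1: "successively (\<lambda>u v. {u, v} \<in> gedges G) (q1 @ [z])"
    and uq: "{u, hd (q1 @ [z])} \<in> gedges G"
    by (auto simp: successively_Cons)
  have "successively (\<lambda>u v. {u, v} \<in> gedges G) (z # rev q1)"
    using q1 successively_rev_edges[of "gedges G" "q1 @ [z]"] by simp
  then have "successively (\<lambda>u v. {u, v} \<in> gedges G) (((u # p1) @ [z]) @ rev q1)"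
    using p1 by (subst successively_append_iff) (auto simp: successively_Cons)
  then have "successively (\<lambda>u v. {u, v} \<in> gedges G) c"
    by (simp add: c_def)
  moreover have "3 \<le> length c"
  proof -
    \<comment> \<open>If both were empty, both paths would step from \<open>u\<close> directly to
      \<open>z\<close>, against \<open>hd p \<noteq> hd q\<close>.\<close>
    have "p1 \<noteq> [] \<or> q1 \<noteq> []"
      using hd pz(1) qz by auto
    then show ?thesis
      by (cases p1; cases q1) (auto simp: c_def)
  qed
  moreover have "{last c, hd c} \<in> gedges G"
    using uq by (cases q1) (auto simp: c_def insert_commute)
  ultimately have "gcycle G c"
    using dist verts by (auto simp: gcycle_def gpath_def c_def)
  then show ?thesis ..
qed

lemma gpath_unique:
  assumes acyclic: "\<nexists>c. gcycle G c"
  shows "gpath G p \<Longrightarrow> gpath G q \<Longrightarrow> hd p = hd q \<Longrightarrow> last p = last q \<Longrightarrow> p = q"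
proof (induction p arbitrary: q)
  case Nil
  then show ?case by (simp add: gpath_def)
next
  case (Cons u p)
  then obtain q' where q: "q = u # q'"
    by (cases q) (auto simp: gpath_def)
  show ?case
  \<comment> \<open>If one path is just \<open>u\<close>, the other one ends at its own start, hence
    is also just \<open>u\<close> by distinctness.\<close>
  proof (cases "p = [] \<or> q' = []")
    case True
    then show ?thesis
      using Cons.prems q by (auto simp: gpath_def split: if_splits dest: last_in_set)
  next
    case False
    then have "hd p = hd q'"
      using gcycle_of_diverging_paths[of G u p q'] Cons.prems q acyclic by auto
    moreover have "gpath G p" "gpath G q'"
      using False Cons.prems q gpath_suffix[of G "[u]" p] gpath_suffix[of G "[u]" q'] by auto
    ultimately show ?thesis
      using Cons.IH[of q'] Cons.prems(4) False q by simp
  qed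
qed

text \<open>A unit flow around the cycle, made antisymmetric. In a bipartite graph consecutive edges
  of the cycle cross between the sides in opposite directions, so the left-to-right values of
  \<open>g\<close> are the alternating signs.\<close>

lemma circulation_of_gcycle:
  fixes G :: "'v::finite ugraph"
  assumes "gcycle G p"
  obtains g :: "'v \<Rightarrow> 'v \<Rightarrow> real" where
    "\<And>x y. g y x = - g x y" "\<And>x y. g x y \<noteq> 0 \<Longrightarrow> {x, y} \<in> gedges G"
    "\<And>x. (\<Sum>y\<in>UNIV. g x y) = 0" "g (p ! 0) (p ! 1) \<noteq> 0"
proof -
  define L where "L = length p"
  have L: "L \<ge> 3" and dist: "distinct p"
    using assms by (auto simp: gcycle_def gpath_def L_def)
  have nth_eq: "p ! s = p ! s' \<longleftrightarrow> s = s'" if "s < L" "s' < L" for s s'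
    using dist that by (simp add: L_def nth_eq_iff_index_eq)
  define nxt where "nxt s = (if Suc s = L then 0 else Suc s)" for s
  define prv where "prv s = (if s = 0 then L - 1 else s - 1)" for s
  have nxt: "nxt s < L" "prv s < L" "nxt (prv s) = s" "prv (nxt s) = s" if "s < L" for s
    using that L by (auto simp: nxt_def prv_def)
  \<comment> \<open>The arcs of the oriented cycle: one leaves and one enters each vertex of
    \<open>p\<close>, which yields conservation for \<open>g\<close>.\<close>
  define A where "A = {(p ! s, p ! nxt s) | s. s < L}"
  have A_edge: "{x, y} \<in> gedges G" if xy: "(x, y) \<in> A" for x y
  proof -
    obtain s where s: "s < L" "x = p ! s" "y = p ! nxt s"
      using xy by (auto simp: A_def)
    show ?thesis
    proof (cases "Suc s = L")
      case True
      moreover have "p \<noteq> []"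
        using L by (auto simp: L_def)
      ultimately have "x = last p" "y = hd p"
        using s L True last_conv_nth[of p] hd_conv_nth[of p] by (auto simp: nxt_def L_def dest!: sym[of "Suc s"])
      then show ?thesis
        using assms by (simp add: gcycle_def)
    next
      case False
      then show ?thesis
        using s assms
        by (auto simp: gcycle_def gpath_def nxt_def L_def successively_conv_nth)
    qed
  qed
  have out: "(\<Sum>y\<in>UNIV. of_bool ((x, y) \<in> A)) = (of_bool (x \<in> set p) :: real)" for x
  proof (cases "x \<in> set p")
    case True
    then obtain s where s: "s < L" "x = p ! s"
      by (metis L_def in_set_conv_nth)
    then have "(x, y) \<in> A \<longleftrightarrow> y = p ! nxt s" for y
      by (auto simp: A_def nth_eq)
    then show ?thesis using True by simp
  next
    case False
    then have "(x, y) \<notin> A" for y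
      by (auto simp: A_def L_def)
    then show ?thesis using False by simp
  qed
  have into: "(\<Sum>y\<in>UNIV. of_bool ((y, x) \<in> A)) = (of_bool (x \<in> set p) :: real)" for x
  proof (cases "x \<in> set p")
    case True
    then obtain s where s: "s < L" "x = p ! s"
      by (metis L_def in_set_conv_nth)
    have "(y, x) \<in> A \<longleftrightarrow> y = p ! prv s" for y
    proof
      assume "(y, x) \<in> A"
      then obtain s' where "s' < L" "y = p ! s'" "x = p ! nxt s'"
        by (auto simp: A_def)
      then show "y = p ! prv s"
        using s nth_eq nxt by metis
    next
      assume "y = p ! prv s"
      then show "(y, x) \<in> A"
        unfolding A_def using s nxt[OF s(1)] by (auto intro!: exI[of _ "prv s"])
    qed
    then show ?thesis using True by simp
  next
    case False
    then have "(y, x) \<notin> A" for y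
      using nxt by (auto simp: A_def L_def)
    then show ?thesis using False by simp
  qed
  define g where "g x y = (of_bool ((x, y) \<in> A) - of_bool ((y, x) \<in> A) :: real)" for x y
  show ?thesis
  proof (rule that)
    show "g y x = - g x y" for x y
      by (simp add: g_def)
    show "{x, y} \<in> gedges G" if "g x y \<noteq> 0" for x y
      using that A_edge[of x y] A_edge[of y x]
      by (cases "(x, y) \<in> A"; cases "(y, x) \<in> A") (auto simp: g_def insert_commute)
    show "(\<Sum>y\<in>UNIV. g x y) = 0" for x
      by (simp only: g_def sum_subtractf out into)
    have "(p ! 0, p ! 1) \<in> A"
      unfolding A_def using L by (auto simp: nxt_def intro!: exI[of _ 0])
    \<comment> \<open>Length at least 3 matters: on two vertices the arcs would be opposite and
      \<open>g\<close> would cancel to zero.\<close>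
    moreover have "(p ! 1, p ! 0) \<notin> A"
    proof
      assume "(p ! 1, p ! 0) \<in> A"
      then obtain s where "s < L" "p ! 1 = p ! s" "p ! 0 = p ! nxt s"
        by (auto simp: A_def)
      then have "s = 1" "nxt s = 0"
        using nth_eq[of 1 s] nth_eq[of 0 "nxt s"] nxt(1)[of s] L by auto
      then show False
        using L by (auto simp: nxt_def split: if_splits)
    qed
    ultimately show "g (p ! 0) (p ! 1) \<noteq> 0"
      by (simp add: g_def)
  qed
qed

section \<open>Rooted trees\<close>

locale rooted_tree =
  fixes T :: "'v::finite ugraph" and r :: 'v
  assumes tree: "gtree T" and verts: "gverts T = UNIV"
begin

text \<open>The description is proper: connectedness supplies a path to the root, acyclicity makes
  it unique.\<close>

definition root_path :: "'v \<Rightarrow> 'v list" where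
  "root_path v = (THE p. gpath T p \<and> hd p = v \<and> last p = r)"

definition children :: "'v \<Rightarrow> 'v set" where
  "children v = {c. is_parent T r v c}"

lemma root_path_eqI:
  assumes "gpath T p" "hd p = v" "last p = r"
  shows "root_path v = p"
  unfolding root_path_def
proof (rule the_equality)
  show "gpath T p \<and> hd p = v \<and> last p = r"
    using assms by simp
next
  fix q assume "gpath T q \<and> hd q = v \<and> last q = r"
  then show "q = p"
    using gpath_unique[of T q p] tree assms by (auto simp: gtree_def)
qed

lemma root_path:
  shows "gpath T (root_path v)" "hd (root_path v) = v" "last (root_path v) = r"
proof -
  have "\<exists>p. gpath T p \<and> hd p = v \<and> last p = r"
    using tree verts by (simp add: gtree_def gconnected_def)
  then show "gpath T (root_path v)" "hd (root_path v) = v" "last (root_path v) = r"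
    using root_path_eqI by auto
qed

lemma root_path_not_Nil [simp]: "root_path v \<noteq> []"
  using root_path(1)[of v] by (simp add: gpath_def)

lemma root_path_distinct: "distinct (root_path v)"
  using root_path(1)[of v] by (simp add: gpath_def)

lemma root_path_Cons: "root_path v = v # tl (root_path v)"
  using root_path(2)[of v] by (metis list.collapse root_path_not_Nil)

lemma root_path_root: "root_path r = [r]"
  by (rule root_path_eqI) (auto simp: gpath_def verts)

lemma root_path_suffix:
  assumes "root_path x = p @ v # q"
  shows "root_path v = v # q"
proof (rule root_path_eqI)
  show "gpath T (v # q)"
    using assms root_path(1)[of x] gpath_suffix[of T p "v # q"] by simp
  show "last (v # q) = r"
    using root_path(3)[of x] assms by simp
qed simp

text \<open>Uniqueness of root paths turns the parent relation into an equation between lists;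
  comparing lengths, that is depths, then settles questions such as asymmetry.\<close>

lemma is_parent_iff: "is_parent T r x v \<longleftrightarrow> root_path v = v # root_path x"
proof
  assume "is_parent T r x v"
  then obtain p where p: "gpath T (v # x # p)" "last (x # p) = r"
    by (auto simp: is_parent_def)
  then have "root_path v = [v] @ x # p"
    by (intro root_path_eqI) auto
  then show "root_path v = v # root_path x"
    using root_path_suffix[of v "[v]" x p] by simp
next
  assume v: "root_path v = v # root_path x"
  then have "root_path v = v # x # tl (root_path x)"
    using root_path_Cons[of x] by simp
  then show "is_parent T r x v"
    unfolding is_parent_def using root_path(1)[of v] root_path(3)[of x] root_path_Cons[of x] by metis
qed

lemma is_parent_unique: "is_parent T r x v \<Longrightarrow> is_parent T r y v \<Longrightarrow> x = y"
  unfolding is_parent_iff by (metis list.inject root_path(2))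

lemma not_is_parent_root: "\<not> is_parent T r x r"
  by (metis is_parent_iff list.inject root_path_not_Nil root_path_root)

lemma ex_parent:
  assumes "v \<noteq> r"
  shows "\<exists>x. is_parent T r x v"
proof -
  have "tl (root_path v) \<noteq> []"
    using assms root_path(3)[of v] root_path_Cons[of v] by (metis last_ConsL)
  then obtain x q where "tl (root_path v) = x # q"
    by (meson list.exhaust)
  then have "root_path v = v # x # q"
    using root_path_Cons[of v] by simp
  moreover from this have "root_path x = x # q"
    using root_path_suffix[of v "[v]" x q] by simp
  ultimately show ?thesis
    by (intro exI[of _ x]) (simp add: is_parent_iff)
qed

lemma is_parent_asym:
  assumes "is_parent T r x v"
  shows "\<not> is_parent T r v x"
proof
  assume "is_parent T r v x"
  then have "length (root_path x) = Suc (length (root_path v))"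
    by (simp add: is_parent_iff)
  moreover have "length (root_path v) = Suc (length (root_path x))"
    using assms by (simp add: is_parent_iff)
  ultimately show False by simp
qed

lemma is_parent_edge: "is_parent T r x v \<Longrightarrow> {x, v} \<in> gedges T"
  by (auto simp: is_parent_def gpath_def insert_commute)

text \<open>If \<open>y\<close> is off the root path of \<open>x\<close>, prepending
  \<open>y\<close> gives the root path of \<open>y\<close>. Otherwise the root path of
  \<open>y\<close> is a proper suffix of that of \<open>x\<close>, so it avoids \<open>x\<close>,
  and \<open>x\<close> can be prepended.\<close>

lemma edge_is_parent:
  assumes e: "{x, y} \<in> gedges T" and "x \<noteq> y"
  shows "is_parent T r x y \<or> is_parent T r y x"
proof (cases "y \<in> set (root_path x)")
  case False
  have "gpath T (y # root_path x)"
    using False e verts root_path(1,2)[of x] by (intro gpath_Cons) (auto simp: insert_commute)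
  then have "root_path y = y # root_path x"
    using root_path(3)[of x] by (intro root_path_eqI) auto
  then show ?thesis by (simp add: is_parent_iff)
next
  case True
  then obtain p q where pq: "root_path x = p @ y # q"
    by (meson split_list)
  then have y: "root_path y = y # q"
    by (rule root_path_suffix)
  have "p \<noteq> []"
    using pq assms(2) root_path(2)[of x] by auto
  then have "x \<in> set p"
    using pq root_path(2)[of x] by (metis hd_append2 hd_in_set)
  then have "x \<notin> set (y # q)"
    using root_path_distinct[of x] pq by auto
  then have "gpath T (x # root_path y)"
    using e verts root_path(1,2)[of y] y by (intro gpath_Cons) auto
  then have "root_path x = x # root_path y"
    using root_path(3)[of y] by (intro root_path_eqI) auto
  then show ?thesis by (simp add: is_parent_iff)
qed

lemma descendants_iff: "x \<in> descendants T r v \<longleftrightarrow> v \<in> set (root_path x)"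
proof
  assume "x \<in> descendants T r v"
  then obtain p where "gpath T p" "hd p = x" "last p = r" "v \<in> set p"
    by (auto simp: descendants_def)
  then show "v \<in> set (root_path x)"
    using root_path_eqI[of p x] by simp
next
  assume "v \<in> set (root_path x)"
  then show "x \<in> descendants T r v"
    unfolding descendants_def using root_path by blast
qed

lemma root_path_split:
  assumes "v \<in> set (root_path x)"
  obtains p where "root_path x = p @ root_path v"
proof -
  obtain p q where "root_path x = p @ v # q"
    using assms by (meson split_list)
  moreover from this have "root_path v = v # q"
    by (rule root_path_suffix)
  ultimately show ?thesis
    using that by simp
qed

lemma descendants_root: "descendants T r r = UNIV"
proof -
  have "r \<in> set (root_path x)" for x
    using last_in_set[OF root_path_not_Nil[of x]] root_path(3)[of x] by simp
  then show ?thesis by (auto simp: descendants_iff)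
qed

lemma root_in_descendants: "r \<in> descendants T r v \<longleftrightarrow> v = r"
  by (auto simp: descendants_iff root_path_root)

lemma self_in_descendants: "v \<in> descendants T r v"
  using hd_in_set[OF root_path_not_Nil[of v]] root_path(2)[of v] by (simp add: descendants_iff)

lemma descendants_rec: "descendants T r v = insert v (\<Union>c\<in>children v. descendants T r c)"
proof (rule set_eqI, rule iffI)
  fix x assume "x \<in> descendants T r v"
  then have "v \<in> set (root_path x)"
    by (simp add: descendants_iff)
  then obtain p where p: "root_path x = p @ root_path v"
    by (rule root_path_split)
  show "x \<in> insert v (\<Union>c\<in>children v. descendants T r c)"
  proof (cases p rule: rev_cases)
    case Nil
    then have "hd (root_path x) = hd (root_path v)"
      using p by simp
    then have "x = v"
      by (simp only: root_path(2))
    then show ?thesis by simp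
  next
    \<comment> \<open>The vertex just before the tail \<open>root_path v\<close> is the child of
      \<open>v\<close> above \<open>x\<close>.\<close>
    case (snoc p' c)
    then have x: "root_path x = p' @ c # root_path v"
      using p by simp
    then have "is_parent T r v c"
      using root_path_suffix[OF x] by (simp add: is_parent_iff)
    moreover have "x \<in> descendants T r c"
      using x by (simp add: descendants_iff)
    ultimately show ?thesis by (auto simp: children_def)
  qed
next
  fix x assume "x \<in> insert v (\<Union>c\<in>children v. descendants T r c)"
  then consider "x = v" | c where "is_parent T r v c" "c \<in> set (root_path x)"
    by (auto simp: children_def descendants_iff)
  then show "x \<in> descendants T r v"
  proof cases
    case 1
    then show ?thesis by (simp add: self_in_descendants)
  next
    case 2
    obtain p where "root_path x = p @ root_path c"
      using 2(2) by (rule root_path_split)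
    then have "root_path x = p @ c # root_path v"
      using 2(1) by (simp add: is_parent_iff)
    then show ?thesis
      using self_in_descendants[of v] by (auto simp: descendants_iff)
  qed
qed

text \<open>The root paths of both children continue with \<open>root_path v\<close>; on the root
  path of a common descendant the vertex before this tail would be both \<open>c\<close> and
  \<open>c'\<close>.\<close>

lemma descendants_disjoint:
  assumes "c \<in> children v" "c' \<in> children v" "c \<noteq> c'"
  shows "descendants T r c \<inter> descendants T r c' = {}"
proof (rule ccontr)
  assume "\<not> ?thesis"
  then obtain x where "c \<in> set (root_path x)" "c' \<in> set (root_path x)"
    by (auto simp: descendants_iff)
  then obtain p p' where p: "root_path x = p @ root_path c" "root_path x = p' @ root_path c'"
    using root_path_split by metis
  have "root_path c = c # root_path v" "root_path c' = c' # root_path v"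
    using assms by (auto simp: children_def is_parent_iff)
  with p have "(p @ [c]) @ root_path v = (p' @ [c']) @ root_path v"
    by simp
  then have "p @ [c] = p' @ [c']"
    by (simp only: append_same_eq)
  then show False using assms(3) by simp
qed

lemma not_in_descendants_child:
  assumes "c \<in> children v"
  shows "v \<notin> descendants T r c"
proof
  assume "v \<in> descendants T r c"
  then have "c \<in> set (root_path v)"
    by (simp add: descendants_iff)
  then obtain p where p: "root_path v = p @ root_path c"
    by (rule root_path_split)
  have "length (root_path v) = length p + length (root_path c)"
    by (subst p) simp
  moreover have "length (root_path c) = Suc (length (root_path v))"
    using assms by (simp add: children_def is_parent_iff)
  ultimately show False by simp
qed

section \<open>Summation and induction over rooted trees\<close>

lemma sum_descendants:
  fixes f :: "'v \<Rightarrow> 'a::comm_monoid_add"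
  shows "sum f (descendants T r v) = f v + (\<Sum>c\<in>children v. sum f (descendants T r c))"
proof -
  have "sum f (descendants T r v) = f v + sum f (\<Union>c\<in>children v. descendants T r c)"
    unfolding descendants_rec[of v] by (rule sum.insert) (use not_in_descendants_child in auto)
  also have "sum f (\<Union>c\<in>children v. descendants T r c) = (\<Sum>c\<in>children v. sum f (descendants T r c))"
    by (rule sum.UNION_disjoint) (simp_all add: descendants_disjoint)
  finally show ?thesis .
qed

text \<open>Induction from the leaves upwards; descendant sets shrink strictly from a vertex to its
  children.\<close>

lemma tree_induct:
  assumes "\<And>v. (\<And>c. c \<in> children v \<Longrightarrow> Q c) \<Longrightarrow> Q v"
  shows "Q v"
proof (induction "card (descendants T r v)" arbitrary: v rule: less_induct)
  case less
  show ?case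
  proof (rule assms)
    fix c assume c: "c \<in> children v"
    then have "descendants T r c \<subset> descendants T r v"
      using descendants_rec[of v] not_in_descendants_child[OF c] by blast
    then show "Q c"
      by (intro less psubset_card_mono) auto
  qed
qed

text \<open>The sum over the set of parents, empty at the root and a singleton elsewhere, lets one
  formula serve every vertex.\<close>

lemma sum_neighbours:
  fixes E :: "'v \<Rightarrow> 'a::comm_monoid_add"
  assumes "\<And>y. E y \<noteq> 0 \<Longrightarrow> {v, y} \<in> gedges T \<and> v \<noteq> y"
  shows "(\<Sum>y\<in>UNIV. E y) = (\<Sum>x | is_parent T r x v. E x) + (\<Sum>c\<in>children v. E c)"
proof -
  have "(\<Sum>y\<in>UNIV. E y) = sum E ({x. is_parent T r x v} \<union> children v)"
    using assms edge_is_parent by (intro sum.mono_neutral_right) (auto simp: children_def)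
  also have "\<dots> = (\<Sum>x | is_parent T r x v. E x) + (\<Sum>c\<in>children v. E c)"
    using is_parent_asym by (intro sum.union_disjoint) (auto simp: children_def)
  finally show ?thesis .
qed

lemma parent_set: "is_parent T r x v \<Longrightarrow> {x. is_parent T r x v} = {x}"
  using is_parent_unique by auto

text \<open>In the signed sum of vertex sums over a subtree, each inner edge is counted at both ends
  with opposite signs and cancels; only the edge to the parent of \<open>v\<close> survives. The
  induction carries this out one generation at a time.\<close>

lemma flow_from_descendants:
  fixes E :: "'v \<Rightarrow> 'v \<Rightarrow> real" and \<sigma> :: "'v \<Rightarrow> real"
  assumes supp: "\<And>x y. E x y \<noteq> 0 \<Longrightarrow> {x, y} \<in> gedges T \<and> x \<noteq> y"
    and sym: "\<And>x y. E x y = E y x"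
    and sign: "\<And>x y. {x, y} \<in> gedges T \<Longrightarrow> \<sigma> y = - \<sigma> x"
  shows "is_parent T r x v \<Longrightarrow> \<sigma> v * E v x = (\<Sum>y\<in>descendants T r v. \<sigma> y * (\<Sum>z\<in>UNIV. E y z))"
proof (induction v arbitrary: x rule: tree_induct)
  case (1 v)
  have "(\<Sum>z\<in>UNIV. E v z) = E v x + (\<Sum>c\<in>children v. E v c)"
    using sum_neighbours[of "E v" v] supp parent_set[OF 1(2)] by simp
  \<comment> \<open>Since \<open>\<sigma> c = - \<sigma> v\<close> for a child \<open>c\<close>,
    each summand on the right is the left side of the induction hypothesis for
    \<open>c\<close>.\<close>
  then have "\<sigma> v * E v x = \<sigma> v * (\<Sum>z\<in>UNIV. E v z) + (\<Sum>c\<in>children v. - \<sigma> v * E v c)"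
    by (simp add: sum_distrib_left[symmetric] algebra_simps sum_negf)
  also have "(\<Sum>c\<in>children v. - \<sigma> v * E v c)
      = (\<Sum>c\<in>children v. \<Sum>y\<in>descendants T r c. \<sigma> y * (\<Sum>z\<in>UNIV. E y z))"
  proof (rule sum.cong)
    fix c assume c: "c \<in> children v"
    then have "is_parent T r v c" by (simp add: children_def)
    then have "\<sigma> c = - \<sigma> v"
      using sign is_parent_edge by blast
    then show "- \<sigma> v * E v c = (\<Sum>y\<in>descendants T r c. \<sigma> y * (\<Sum>z\<in>UNIV. E y z))"
      using 1(1)[OF c \<open>is_parent T r v c\<close>] sym[of v c] by simp
  qed simp
  finally show ?case
    using sum_descendants[of "\<lambda>y. \<sigma> y * (\<Sum>z\<in>UNIV. E y z)" v] by simp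
qed

end

section \<open>Vertices of transportation polytopes\<close>

lemma mem_transportation_polytope:
  "M \<in> transportation_polytope r c \<longleftrightarrow>
     (\<forall>i j. 0 \<le> M $ i $ j) \<and> (\<forall>i. (\<Sum>j\<in>UNIV. M $ i $ j) = r $ i) \<and>
     (\<forall>j. (\<Sum>i\<in>UNIV. M $ i $ j) = c $ j)"
  by (simp add: transportation_polytope_def)

text \<open>The direction space of the affine subspace given by fixed margins.\<close>

definition zero_sums :: "real ^ 'n ^ 'm \<Rightarrow> bool" where
  "zero_sums D \<longleftrightarrow> (\<forall>i. (\<Sum>j\<in>UNIV. D $ i $ j) = 0) \<and> (\<forall>j. (\<Sum>i\<in>UNIV. D $ i $ j) = 0)"

text \<open>A nonzero direction \<open>D\<close> on the support allows small moves both ways, making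
  \<open>M\<close> a midpoint. Conversely, if \<open>M\<close> is inside a segment from
  \<open>A\<close> to \<open>B\<close>, then \<open>A - B\<close> is such a direction.\<close>

lemma polytope_vertex_iff:
  fixes M :: "real ^ 'n::finite ^ 'm::finite"
  shows "M \<in> polytope_vertices (transportation_polytope r c) \<longleftrightarrow>
    M \<in> transportation_polytope r c \<and>
    (\<forall>D. zero_sums D \<longrightarrow> (\<forall>i j. D $ i $ j \<noteq> 0 \<longrightarrow> M $ i $ j > 0) \<longrightarrow> D = 0)"
    (is "?L \<longleftrightarrow> ?P M \<and> ?R")
proof
  assume L: ?L
  then have P: "?P M"
    by (simp add: polytope_vertices_def extreme_point_of_def)
  have "D = 0" if Z: "zero_sums D" and supp: "\<And>i j. D $ i $ j \<noteq> 0 \<Longrightarrow> M $ i $ j > 0" for D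
  proof (rule ccontr)
    assume "D \<noteq> 0"
    have "\<exists>e>0. e * \<bar>D $ i $ j\<bar> \<le> M $ i $ j" for i j
    proof (cases "D $ i $ j = 0")
      case True
      then show ?thesis
        using P by (intro exI[of _ 1]) (auto simp: mem_transportation_polytope)
    next
      case False
      then show ?thesis
        using supp[of i j] by (intro exI[of _ "M $ i $ j / \<bar>D $ i $ j\<bar>"]) auto
    qed
    then obtain e where e: "\<And>i j. e i j > 0" "\<And>i j. e i j * \<bar>D $ i $ j\<bar> \<le> M $ i $ j"
      by metis
    \<comment> \<open>One step length that keeps all entries nonnegative for both signs of the
      move.\<close>
    define \<epsilon> where "\<epsilon> = Min (range (\<lambda>(i, j). e i j))"
    have "\<epsilon> > 0"
      unfolding \<epsilon>_def using e(1) by (subst Min_gr_iff) auto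
    have "\<epsilon> \<le> e i j" for i j
      unfolding \<epsilon>_def by (rule Min_le) (auto intro!: rev_image_eqI[of "(i, j)"])
    then have \<epsilon>: "\<epsilon> * \<bar>D $ i $ j\<bar> \<le> M $ i $ j" for i j
      using e(2)[of i j] by (meson abs_ge_zero mult_right_mono order_trans)
    have mem: "?P (M + s *\<^sub>R D)" if "\<bar>s\<bar> = \<epsilon>" for s
    proof -
      have "- (s * D $ i $ j) \<le> M $ i $ j" for i j
      proof -
        have "\<bar>s * D $ i $ j\<bar> \<le> M $ i $ j"
          using \<epsilon>[of i j] that by (simp add: abs_mult)
        then show ?thesis by linarith
      qed
      then have "0 \<le> M $ i $ j + s * D $ i $ j" for i j
        by (metis add.commute diff_ge_0_iff_ge diff_minus_eq_add)
      then show ?thesis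
        using P Z by (auto simp: mem_transportation_polytope zero_sums_def sum.distrib
            simp flip: sum_distrib_left)
    qed
    have "midpoint (M + \<epsilon> *\<^sub>R D) (M + (- \<epsilon>) *\<^sub>R D) = M"
      by (simp add: midpoint_def scaleR_2 flip: scaleR_add_left)
    moreover have "M + \<epsilon> *\<^sub>R D \<noteq> M + (- \<epsilon>) *\<^sub>R D"
    proof
      assume "M + \<epsilon> *\<^sub>R D = M + (- \<epsilon>) *\<^sub>R D"
      then have "(2 * \<epsilon>) *\<^sub>R D = 0"
        by (simp add: algebra_simps flip: scaleR_2)
      then show False using \<open>D \<noteq> 0\<close> \<open>\<epsilon> > 0\<close> by simp
    qed
    ultimately have "M \<in> open_segment (M + \<epsilon> *\<^sub>R D) (M + (- \<epsilon>) *\<^sub>R D)"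
      using midpoint_in_open_segment by metis
    then show False
      using L mem[of \<epsilon>] mem[of "- \<epsilon>"] \<open>\<epsilon> > 0\<close>
      by (auto simp: polytope_vertices_def extreme_point_of_def)
  qed
  with P show "?P M \<and> ?R" by blast
next
  assume R: "?P M \<and> ?R"
  have False if A: "?P A" and B: "?P B" and seg: "M \<in> open_segment A B" for A B
  proof -
    obtain u where u: "0 < u" "u < 1" "M = (1 - u) *\<^sub>R A + u *\<^sub>R B" and "A \<noteq> B"
      using seg by (auto simp: in_segment)
    \<comment> \<open>Where two nonnegative entries differ one is positive, and both have positive
      weight in \<open>M\<close>.\<close>
    have "M $ i $ j > 0" if "(A - B) $ i $ j \<noteq> 0" for i j
    proof -
      have "0 \<le> A $ i $ j" "0 \<le> B $ i $ j"
        using A B by (auto simp: mem_transportation_polytope)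
      moreover from this that have "0 < A $ i $ j \<or> 0 < B $ i $ j"
        by auto
      ultimately show ?thesis
        using u by (auto intro: add_pos_nonneg add_nonneg_pos)
    qed
    moreover have "zero_sums (A - B)"
      using A B by (simp add: zero_sums_def mem_transportation_polytope sum_subtractf)
    ultimately have "A - B = 0"
      using R by blast
    then show False using \<open>A \<noteq> B\<close> by simp
  qed
  then show ?L
    using R by (auto simp: polytope_vertices_def extreme_point_of_def)
qed

section \<open>Cycles in auxiliary graphs\<close>

lemma auxiliary_edge [simp]:
  "{Inl i, Inr j} \<in> gedges (auxiliary_graph M) \<longleftrightarrow> M $ i $ j > 0"
  "{Inr j, Inl i} \<in> gedges (auxiliary_graph M) \<longleftrightarrow> M $ i $ j > 0"
  "{Inl i, Inl i'} \<notin> gedges (auxiliary_graph M)"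
  "{Inr j, Inr j'} \<notin> gedges (auxiliary_graph M)"
  by (auto simp: auxiliary_graph_def doubleton_eq_iff)

lemma gverts_auxiliary_graph [simp]: "gverts (auxiliary_graph M) = UNIV"
  by (simp add: auxiliary_graph_def)

lemma sum_UNIV_Plus:
  fixes f :: "'a::finite + 'b::finite \<Rightarrow> 'c::comm_monoid_add"
  shows "(\<Sum>x\<in>UNIV. f x) = (\<Sum>i\<in>UNIV. f (Inl i)) + (\<Sum>j\<in>UNIV. f (Inr j))"
  by (simp add: UNIV_Plus_UNIV[symmetric] sum.Plus del: UNIV_Plus_UNIV)

text \<open>The left-to-right part of the circulation is a matrix on the support of
  \<open>M\<close>. Its row sums are net outflows of left vertices and, by antisymmetry, its column
  sums are negated outflows of right vertices, so all vanish.\<close>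

lemma auxiliary_graph_acyclic:
  fixes M :: "real ^ 'n::finite ^ 'm::finite"
  assumes "M \<in> polytope_vertices (transportation_polytope r c)"
  shows "\<not> gcycle (auxiliary_graph M) p"
proof
  assume "gcycle (auxiliary_graph M) p"
  from circulation_of_gcycle[OF this] obtain g :: "'m + 'n \<Rightarrow> 'm + 'n \<Rightarrow> real" where
    anti: "\<And>x y. g y x = - g x y" and
    edge: "\<And>x y. g x y \<noteq> 0 \<Longrightarrow> {x, y} \<in> gedges (auxiliary_graph M)" and
    sum0: "\<And>x. (\<Sum>y\<in>UNIV. g x y) = 0" and nz: "g (p ! 0) (p ! 1) \<noteq> 0"
    by metis
  have same: "g (Inl i) (Inl i') = 0" "g (Inr j) (Inr j') = 0" for i i' j j'
    using edge auxiliary_edge(3,4) by blast+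
  define D :: "real ^ 'n ^ 'm" where "D = (\<chi> i j. g (Inl i) (Inr j))"
  have "zero_sums D"
    unfolding zero_sums_def
  proof (intro conjI allI)
    fix i show "(\<Sum>j\<in>UNIV. D $ i $ j) = 0"
      using sum0[of "Inl i"] by (simp add: D_def sum_UNIV_Plus same)
  next
    fix j
    have "(\<Sum>i\<in>UNIV. g (Inr j) (Inl i)) = 0"
      using sum0[of "Inr j"] by (simp add: sum_UNIV_Plus same)
    moreover have "D $ i $ j = - g (Inr j) (Inl i)" for i
      using anti[where x = "Inr j" and y = "Inl i"] by (simp add: D_def)
    ultimately show "(\<Sum>i\<in>UNIV. D $ i $ j) = 0"
      by (simp add: sum_negf)
  qed
  moreover have "D $ i $ j \<noteq> 0 \<Longrightarrow> M $ i $ j > 0" for i j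
    using edge[of "Inl i" "Inr j"] by (simp add: D_def)
  ultimately have "D = 0"
    using assms unfolding polytope_vertex_iff by blast
  moreover have "g (Inl i) (Inr j) = D $ i $ j" for i j
    by (simp add: D_def)
  ultimately have 0: "g (Inl i) (Inr j) = 0" for i j
    by simp
  then have "g (Inr j) (Inl i) = 0" for i j
    using anti[where x = "Inl i" and y = "Inr j"] by simp
  with 0 same have "g x y = 0" for x y
    by (cases x; cases y) simp_all
  then show False using nz by simp
qed

text \<open>The symmetric weighted adjacency matrix of the bipartite graph: row and column sums both
  become vertex sums, to which the results on rooted trees apply.\<close>

definition bip_entry :: "real ^ 'n ^ 'm \<Rightarrow> 'm + 'n \<Rightarrow> 'm + 'n \<Rightarrow> real" where
  "bip_entry M x y =
     (case x of Inl i \<Rightarrow> (case y of Inl _ \<Rightarrow> 0 | Inr j \<Rightarrow> M $ i $ j)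
      | Inr j \<Rightarrow> (case y of Inl i \<Rightarrow> M $ i $ j | Inr _ \<Rightarrow> 0))"

lemma bip_entry_simps [simp]:
  "bip_entry M (Inl i) (Inl i') = 0" "bip_entry M (Inr j) (Inr j') = 0"
  "bip_entry M (Inl i) (Inr j) = M $ i $ j" "bip_entry M (Inr j) (Inl i) = M $ i $ j"
  by (simp_all add: bip_entry_def)

lemma sum_bip_entry [simp]:
  "(\<Sum>y\<in>UNIV. bip_entry M (Inl i) y) = (\<Sum>j\<in>UNIV. M $ i $ j)"
  "(\<Sum>y\<in>UNIV. bip_entry M (Inr j) y) = (\<Sum>i\<in>UNIV. M $ i $ j)"
  by (simp_all add: sum_UNIV_Plus)

lemma bip_entry_commute: "bip_entry M x y = bip_entry M y x"
  by (cases x; cases y) simp_all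

section \<open>Bipartite spanning trees\<close>

text \<open>The sign that flips along every bipartite edge, used as \<open>\<sigma>\<close> in
  \<open>flow_from_descendants\<close>.\<close>

definition side :: "'m + 'n \<Rightarrow> real" where
  "side x = (case x of Inl _ \<Rightarrow> 1 | Inr _ \<Rightarrow> - 1)"

lemma side_simps [simp]: "side (Inl i) = 1" "side (Inr j) = - 1"
  by (simp_all add: side_def)

lemma gedges_complete_bipartite:
  "gedges complete_bipartite = {{Inl i, Inr j} | i j. True}"
  by (simp add: complete_bipartite_def)

locale bipartite_tree =
  fixes T :: "('m::finite + 'n::finite) ugraph" and w :: 'n
  assumes sp: "spanning_tree T complete_bipartite"
begin

sublocale rooted_tree T "Inr w"
  using sp by unfold_locales
    (auto simp: spanning_tree_def spanning_subgraph_def complete_bipartite_def)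

lemma no_edge [simp]: "{Inl i, Inl i'} \<notin> gedges T" "{Inr j, Inr j'} \<notin> gedges T"
  using sp by (auto simp: spanning_tree_def spanning_subgraph_def gedges_complete_bipartite
      doubleton_eq_iff dest!: subsetD)

lemma not_is_parent_same [simp]:
  "\<not> is_parent T (Inr w) (Inl i) (Inl i')" "\<not> is_parent T (Inr w) (Inr j) (Inr j')"
  using is_parent_edge no_edge by blast+

lemma edgeE:
  assumes "e \<in> gedges T"
  obtains i j where "e = {Inl i, Inr j}"
  using assms sp
  by (auto simp: spanning_tree_def spanning_subgraph_def gedges_complete_bipartite)

lemma flow:
  assumes supp: "\<And>i j. M $ i $ j \<noteq> 0 \<Longrightarrow> {Inl i, Inr j} \<in> gedges T"
    and "is_parent T (Inr w) x v"
  shows "side v * bip_entry M v x =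
    (\<Sum>y\<in>descendants T (Inr w) v. side y * (\<Sum>z\<in>UNIV. bip_entry M y z))"
proof (rule flow_from_descendants[OF _ bip_entry_commute _ assms(2)])
  show "{x, y} \<in> gedges T \<and> x \<noteq> y" if "bip_entry M x y \<noteq> 0" for x y
    using that supp by (cases x; cases y) (auto simp: insert_commute)
  show "side y = - side x" if "{x, y} \<in> gedges T" for x y
    using that by (cases x; cases y) auto
qed

text \<open>Every tree edge joins a vertex to its parent, and \<open>flow\<close> expresses its
  entry through vertex sums, which are all zero.\<close>

lemma zero_sums_imp_zero:
  assumes "zero_sums D" and supp: "\<And>i j. D $ i $ j \<noteq> 0 \<Longrightarrow> {Inl i, Inr j} \<in> gedges T"
  shows "D = 0"
proof -
  have S: "(\<Sum>z\<in>UNIV. bip_entry D y z) = 0" for y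
    using assms(1) by (cases y) (auto simp: zero_sums_def)
  have 0: "bip_entry D v x = 0" if "is_parent T (Inr w) x v" for x v
    using flow[of D, OF supp that] by (cases v) (auto simp: S)
  have "D $ i $ j = 0" for i j
  proof (cases "{Inl i, Inr j} \<in> gedges T")
    case True
    then show ?thesis
      using edge_is_parent[OF True] 0[of "Inl i" "Inr j"] 0[of "Inr j" "Inl i"] by auto
  qed (use supp in blast)
  then show ?thesis by (simp add: vec_eq_iff)
qed

text \<open>Written as a sum so that \<open>sum_descendants\<close> yields its recursion over
  children.\<close>

definition lcount :: "'m + 'n \<Rightarrow> nat" where
  "lcount v = (\<Sum>y\<in>descendants T (Inr w) v. case y of Inl _ \<Rightarrow> 1 | Inr _ \<Rightarrow> 0)"

definition rcount :: "'m + 'n \<Rightarrow> nat" where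
  "rcount v = (\<Sum>y\<in>descendants T (Inr w) v. case y of Inl _ \<Rightarrow> 0 | Inr _ \<Rightarrow> 1)"

lemma lcount_rec:
  "lcount (Inl i) = 1 + (\<Sum>c\<in>children (Inl i). lcount c)"
  "lcount (Inr j) = (\<Sum>c\<in>children (Inr j). lcount c)"
  unfolding lcount_def by (subst sum_descendants, simp)+

lemma rcount_rec: "rcount (Inr j) = 1 + (\<Sum>c\<in>children (Inr j). rcount c)"
  unfolding rcount_def by (subst sum_descendants, simp)

lemma count_root:
  "lcount (Inr w) = CARD('m)" "rcount (Inr w) = CARD('n)"
  by (simp_all add: lcount_def rcount_def descendants_root sum_UNIV_Plus)

lemma lcount_le: "lcount v \<le> CARD('m)"
proof -
  have "lcount v \<le> lcount (Inr w)"
    unfolding lcount_def descendants_root by (rule sum_mono2) auto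
  then show ?thesis by (simp add: count_root)
qed

lemma left_count_subtree: "left_count (subtree T (Inr w) v) = lcount v"
proof -
  have "lcount v = card {y \<in> descendants T (Inr w) v. \<exists>i. y = Inl i}"
    unfolding lcount_def card_eq_sum
    by (subst sum.inter_filter, simp, rule sum.cong) (auto split: sum.splits)
  also have "{y \<in> descendants T (Inr w) v. \<exists>i. y = Inl i} = Inl ` {i. Inl i \<in> descendants T (Inr w) v}"
    by auto
  finally show ?thesis
    by (simp add: left_count_def subtree_def card_image)
qed

text \<open>Only the root lacks a parent edge. Hence degree \<open>k\<close> at \<open>w\<close> and
  \<open>k + 1\<close> elsewhere means that every right vertex has exactly \<open>k\<close>
  children.\<close>

lemma degree_eq:
  "right_degree_sequence T j = card (children (Inr j)) + (if j = w then 0 else 1)"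
proof -
  have "{e \<in> gedges T. Inr j \<in> e} = (\<lambda>x. {Inr j, x}) ` ({x. is_parent T (Inr w) x (Inr j)} \<union> children (Inr j))"
  proof (rule set_eqI, rule iffI)
    fix e assume e: "e \<in> {e \<in> gedges T. Inr j \<in> e}"
    then obtain i where i: "e = {Inr j, Inl i}"
      by (auto elim!: edgeE)
    then have "is_parent T (Inr w) (Inl i) (Inr j) \<or> is_parent T (Inr w) (Inr j) (Inl i)"
      using e edge_is_parent[of "Inl i" "Inr j"] by (auto simp: insert_commute)
    then show "e \<in> (\<lambda>x. {Inr j, x}) ` ({x. is_parent T (Inr w) x (Inr j)} \<union> children (Inr j))"
      using i by (auto simp: children_def)
  next
    fix e assume "e \<in> (\<lambda>x. {Inr j, x}) ` ({x. is_parent T (Inr w) x (Inr j)} \<union> children (Inr j))"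
    then obtain x where x: "e = {Inr j, x}"
        "is_parent T (Inr w) x (Inr j) \<or> is_parent T (Inr w) (Inr j) x"
      by (auto simp: children_def)
    then have "e \<in> gedges T"
      using is_parent_edge by (metis insert_commute)
    then show "e \<in> {e \<in> gedges T. Inr j \<in> e}"
      using x by simp
  qed
  then have "right_degree_sequence T j = card ({x. is_parent T (Inr w) x (Inr j)} \<union> children (Inr j))"
    by (simp add: right_degree_sequence_def card_image inj_on_def doubleton_eq_iff)
  also have "\<dots> = card {x. is_parent T (Inr w) x (Inr j)} + card (children (Inr j))"
    using is_parent_asym by (intro card_Un_disjoint) (auto simp: children_def)
  also have "card {x. is_parent T (Inr w) x (Inr j)} = (if j = w then 0 else 1)"
  proof (cases "j = w")
    case True
    then show ?thesis by (simp add: not_is_parent_root)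
  next
    case False
    then obtain x where "is_parent T (Inr w) x (Inr j)"
      using ex_parent[of "Inr j"] by auto
    then show ?thesis using False by (simp add: parent_set)
  qed
  finally show ?thesis by simp
qed

lemma children_Inr: "children (Inr j) = Inl ` {i. is_parent T (Inr w) (Inr j) (Inl i)}"
proof (rule set_eqI)
  fix x show "x \<in> children (Inr j) \<longleftrightarrow> x \<in> Inl ` {i. is_parent T (Inr w) (Inr j) (Inl i)}"
    by (cases x) (auto simp: children_def)
qed

lemma ex_parent_Inl: "\<exists>j. is_parent T (Inr w) (Inr j) (Inl i)"
proof -
  obtain x where "is_parent T (Inr w) x (Inl i)"
    using ex_parent[of "Inl i"] by auto
  then show ?thesis by (cases x) auto
qed

text \<open>The root is a right vertex, so each left vertex is the child of exactly one right
  vertex.\<close>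

lemma sum_card_children: "(\<Sum>j\<in>UNIV. card (children (Inr j))) = CARD('m)"
proof -
  have "(\<Sum>j\<in>UNIV. card (children (Inr j))) = (\<Sum>j\<in>UNIV. card {i. is_parent T (Inr w) (Inr j) (Inl i)})"
    by (simp add: children_Inr card_image)
  also have "\<dots> = card (\<Union>j. {i. is_parent T (Inr w) (Inr j) (Inl i)})"
    by (rule card_UN_disjoint[symmetric]) (auto dest: is_parent_unique)
  also have "(\<Union>j. {i. is_parent T (Inr w) (Inr j) (Inl i)}) = UNIV"
    using ex_parent_Inl by auto
  finally show ?thesis .
qed

end

text \<open>The difference of two such matrices has zero margins and lives on the common support, so
  it vanishes.\<close>

lemma vertex_eq_if_auxiliary_graph_eq:
  fixes M N :: "real ^ 'n::finite ^ 'm::finite"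
  assumes "M \<in> polytope_vertices (transportation_polytope r c)"
    and "N \<in> polytope_vertices (transportation_polytope r c)"
    and "auxiliary_graph M = auxiliary_graph N"
  shows "M = N"
proof -
  have M: "M \<in> transportation_polytope r c" and N: "N \<in> transportation_polytope r c"
    using assms(1,2) by (auto simp: polytope_vertex_iff)
  have "M $ i $ j > 0 \<longleftrightarrow> N $ i $ j > 0" for i j
    using auxiliary_edge(1)[of i j M] auxiliary_edge(1)[of i j N] assms(3) by simp
  moreover have "0 \<le> M $ i $ j" "0 \<le> N $ i $ j" for i j
    using M N by (auto simp: mem_transportation_polytope)
  ultimately have "M $ i $ j > 0" if "(M - N) $ i $ j \<noteq> 0" for i j
    using that by (metis diff_self less_eq_real_def vector_minus_component)
  moreover have "zero_sums (M - N)"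
    using M N by (simp add: zero_sums_def mem_transportation_polytope sum_subtractf)
  ultimately have "M - N = 0"
    using assms(1) unfolding polytope_vertex_iff by blast
  then show ?thesis by simp
qed

text \<open>Double counting of the entries in \<open>I \<times> J\<close>; it is applied to the rows
  and columns of a connected component.\<close>

lemma block_sums_eq:
  fixes M :: "real ^ 'n::finite ^ 'm::finite"
  assumes "M \<in> transportation_polytope r c"
    and block: "\<And>i j. M $ i $ j > 0 \<Longrightarrow> i \<in> I \<longleftrightarrow> j \<in> J"
  shows "(\<Sum>i\<in>I. r $ i) = (\<Sum>j\<in>J. c $ j)"
proof -
  have 0: "M $ i $ j = 0" if "\<not> (i \<in> I \<longleftrightarrow> j \<in> J)" for i j
  proof -
    have "0 \<le> M $ i $ j"
      using assms(1) by (simp add: mem_transportation_polytope)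
    then show ?thesis
      using block[of i j] that by (cases "M $ i $ j > 0") auto
  qed
  have "(\<Sum>i\<in>I. r $ i) = (\<Sum>i\<in>I. \<Sum>j\<in>UNIV. M $ i $ j)"
    using assms(1) by (simp add: mem_transportation_polytope)
  also have "\<dots> = (\<Sum>i\<in>I. \<Sum>j\<in>J. M $ i $ j)"
    by (intro sum.cong refl sum.mono_neutral_right) (auto simp: 0)
  also have "\<dots> = (\<Sum>j\<in>J. \<Sum>i\<in>I. M $ i $ j)"
    by (rule sum.swap)
  also have "\<dots> = (\<Sum>j\<in>J. \<Sum>i\<in>UNIV. M $ i $ j)"
    by (intro sum.cong refl sum.mono_neutral_left) (auto simp: 0)
  also have "\<dots> = (\<Sum>j\<in>J. c $ j)"
    using assms(1) by (simp add: mem_transportation_polytope)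
  finally show ?thesis .
qed

text \<open>As \<open>v\<close> is not the root, the root is not among its descendants, and the
  exceptional column sum at \<open>w\<close> does not enter.\<close>

lemma (in bipartite_tree) sum_side:
  fixes f :: "'m + 'n \<Rightarrow> real"
  assumes "\<And>i. f (Inl i) = \<alpha>" and "\<And>j. j \<noteq> w \<Longrightarrow> f (Inr j) = \<beta>" and "v \<noteq> Inr w"
  shows "(\<Sum>y\<in>descendants T (Inr w) v. side y * f y) = real (lcount v) * \<alpha> - real (rcount v) * \<beta>"
proof -
  have "side y * f y = real (case y of Inl _ \<Rightarrow> 1 | Inr _ \<Rightarrow> 0) * \<alpha>
      - real (case y of Inl _ \<Rightarrow> 0 | Inr _ \<Rightarrow> 1) * \<beta>"
    if "y \<in> descendants T (Inr w) v" for y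
  proof (cases y)
    case (Inl i)
    then show ?thesis by (simp add: assms(1))
  next
    case (Inr j)
    then have "j \<noteq> w"
      using that assms(3) root_in_descendants by auto
    then show ?thesis using Inr by (simp add: assms(2))
  qed
  then show ?thesis
    by (simp add: lcount_def rcount_def sum_distrib_right sum_subtractf)
qed

section \<open>The perturbed polytope\<close>

locale perturbed_transportation =
  fixes k a b :: nat and w :: "'n::finite" and t :: real and P :: "(real ^ 'n ^ 'm::finite) set"
  assumes card_m: "CARD('m) = k * CARD('n)" and k_pos: "k \<ge> 1" and b_pos: "b \<ge> 1"
    and total: "CARD('m) * a = CARD('n) * b"
    and t_pos: "0 < t" and t_small: "real CARD('m) * t < 1"
    and P_def: "P = transportation_polytope (row_sums a t) (col_sums w CARD('m) b t)"
begin

lemma b_eq: "b = k * a"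
  using total card_m by simp

lemma a_pos: "a \<ge> 1"
  using b_pos b_eq by (cases a) auto

lemma mult_t_less: "l \<le> CARD('m) \<Longrightarrow> real l * t < 1"
  using t_small t_pos by (meson le_less_trans less_imp_le mult_right_mono of_nat_mono)

lemma auxiliary_graph_connected:
  assumes "M \<in> P"
  shows "gconnected (auxiliary_graph M)"
proof -
  have "\<exists>p. gpath (auxiliary_graph M) p \<and> hd p = u \<and> last p = v" for u v
  proof -
    \<comment> \<open>The component of \<open>u\<close>; the goal is that it contains every
      vertex.\<close>
    define C where "C = {x. \<exists>p. gpath (auxiliary_graph M) p \<and> hd p = u \<and> last p = x}"
    have closed: "y \<in> C" if x: "x \<in> C" and e: "{x, y} \<in> gedges (auxiliary_graph M)" for x y
    proof -
      obtain p where p: "gpath (auxiliary_graph M) p" "hd p = u" "last p = x"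
        using x by (auto simp: C_def)
      then show ?thesis
        using gpath_extend[OF p(1), of y] e by (auto simp: C_def)
    qed
    have "gpath (auxiliary_graph M) [u]"
      by (simp add: gpath_def)
    then have u: "u \<in> C"
      unfolding C_def by force
    define I where "I = {i. Inl i \<in> C}"
    define J where "J = {j. Inr j \<in> C}"
    have "i \<in> I \<longleftrightarrow> j \<in> J" if "M $ i $ j > 0" for i j
      using that closed[of "Inl i" "Inr j"] closed[of "Inr j" "Inl i"] by (auto simp: I_def J_def)
    then have "(\<Sum>i\<in>I. row_sums a t $ i) = (\<Sum>j\<in>J. col_sums w CARD('m) b t $ j)"
      using assms unfolding P_def by (rule block_sums_eq[rotated])
    also have "(\<Sum>j\<in>J. col_sums w CARD('m) b t $ j)
        = (\<Sum>j\<in>J. real b - (if j = w then real CARD('m) * t else 0))"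
      by (rule sum.cong) (auto simp: col_sums_def)
    finally have sums: "real (card I) * (real a - t)
        = real (card J) * real b - (if w \<in> J then real CARD('m) * t else 0)"
      by (simp add: row_sums_def sum_subtractf)
    \<comment> \<open>The unperturbed imbalance of the component. It is an integer and equals a
      difference of two numbers in \<open>[0, 1)\<close>, so it is zero.\<close>
    define s :: int where "s = int (card I * a) - int (card J * b)"
    have s: "real_of_int s = real (card I) * t - (if w \<in> J then real CARD('m) * t else 0)"
      using sums by (simp add: s_def algebra_simps)
    have I: "card I \<le> CARD('m)"
      by (rule card_mono) auto
    have "0 \<le> real (card I) * t" "real (card I) * t < 1"
      using mult_t_less[OF I] t_pos by auto
    moreover have "0 \<le> (if w \<in> J then real CARD('m) * t else 0)"
      "(if w \<in> J then real CARD('m) * t else 0) < 1"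
      using t_pos t_small by auto
    ultimately have "\<bar>real_of_int s\<bar> < 1"
      unfolding s abs_less_iff by linarith
    then have s0: "s = 0"
      by linarith
    then have IJ: "card I * a = card J * b"
      unfolding s_def by linarith
    \<comment> \<open>Without \<open>w\<close> the perturbation would be
      \<open>card I * t = 0\<close>, leaving the component empty. With \<open>w\<close> it forces
      \<open>card I\<close> to be the full number of rows.\<close>
    have w: "w \<in> J"
    proof (rule ccontr)
      assume "w \<notin> J"
      then have "card I = 0"
        using s s0 t_pos by simp
      moreover from this have "card J = 0"
        using IJ b_pos by simp
      ultimately have "I = {}" "J = {}"
        by simp_all
      then show False
        using u by (cases u) (auto simp: I_def J_def)
    qed
    then have cI: "card I = CARD('m)"
      using s s0 t_pos by simp
    then have "card J = CARD('n)"
      using IJ total b_pos by simp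
    with cI have "I = UNIV" "J = UNIV"
      by (simp_all add: card_eq_UNIV_imp_eq_UNIV)
    then have "v \<in> C"
      by (cases v) (auto simp: I_def J_def)
    then show ?thesis
      by (simp add: C_def)
  qed
  then show ?thesis
    by (simp add: gconnected_def)
qed

lemma auxiliary_graph_spanning_tree:
  assumes "M \<in> polytope_vertices P"
  shows "spanning_tree (auxiliary_graph M) complete_bipartite"
proof -
  have "M \<in> P"
    using assms by (simp add: polytope_vertices_def extreme_point_of_def)
  then have "gtree (auxiliary_graph M)"
    using auxiliary_graph_connected auxiliary_graph_acyclic assms
    unfolding gtree_def P_def by blast
  then show ?thesis
    by (auto simp: spanning_tree_def spanning_subgraph_def complete_bipartite_def auxiliary_graph_def)
qed

lemma right_degree_auxiliary_graph:
  assumes "M \<in> polytope_vertices P"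
  shows "right_degree_sequence (auxiliary_graph M) = (\<lambda>j. if j = w then k else k + 1)"
proof -
  define G where "G = auxiliary_graph M"
  have MP: "M \<in> P"
    using assms by (simp add: polytope_vertices_def extreme_point_of_def)
  interpret bipartite_tree G w
    using auxiliary_graph_spanning_tree[OF assms] by unfold_locales (simp add: G_def)
  have supp: "{Inl i, Inr j} \<in> gedges G" if "M $ i $ j \<noteq> 0" for i j
  proof -
    have "0 \<le> M $ i $ j"
      using MP by (simp add: P_def mem_transportation_polytope)
    then show ?thesis using that by (simp add: G_def)
  qed
  have pos: "0 < bip_entry M v x" if "is_parent G (Inr w) x v" for v x
    using is_parent_edge[OF that] unfolding G_def by (cases v; cases x) simp_all
  have val: "side v * bip_entry M v x
      = real (lcount v) * (real a - t) - real (rcount v) * real b"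
    if "is_parent G (Inr w) x v" for v x
  proof -
    have "v \<noteq> Inr w"
      using that not_is_parent_root by blast
    moreover have "(\<Sum>z\<in>UNIV. bip_entry M (Inl i) z) = real a - t" for i
      using MP by (simp add: P_def mem_transportation_polytope row_sums_def)
    moreover have "(\<Sum>z\<in>UNIV. bip_entry M (Inr j) z) = real b" if "j \<noteq> w" for j
      using MP that by (simp add: P_def mem_transportation_polytope col_sums_def)
    ultimately show ?thesis
      using flow[of M, OF supp that] sum_side[of "\<lambda>y. \<Sum>z\<in>UNIV. bip_entry M y z"] by simp
  qed
  \<comment> \<open>With \<open>b = k * a\<close>, positivity gives
    \<open>a * (lcount c - k * rcount c) > lcount c * t \<ge> 0\<close>, and the integer factor is
    then at least 1.\<close>
  have child: "lcount c \<ge> k * rcount c + 1" if "c \<in> children (Inr j)" for c j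
  proof -
    have par: "is_parent G (Inr w) (Inr j) c"
      using that by (simp add: children_def)
    have "side c = 1"
      using that by (auto simp: children_Inr)
    then have "0 < real (lcount c) * (real a - t) - real (rcount c) * real b"
      using val[OF par] pos[OF par] by simp
    also have "\<dots> = real_of_int (int a * (int (lcount c) - int k * int (rcount c))) - real (lcount c) * t"
      by (simp add: b_eq algebra_simps)
    also have "\<dots> \<le> real_of_int (int a * (int (lcount c) - int k * int (rcount c)))"
      using t_pos by simp
    finally have "0 < int a * (int (lcount c) - int k * int (rcount c))"
      by linarith
    then have "0 < int (lcount c) - int k * int (rcount c)"
      using a_pos by (simp add: zero_less_mult_iff)
    then have "int (k * rcount c + 1) \<le> int (lcount c)"
      by simp
    then show ?thesis by (simp only: of_nat_le_iff)
  qed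
  \<comment> \<open>At the root this is an equality of total counts. Elsewhere the sign is reversed:
    \<open>a * (lcount - k * rcount) < lcount * t < 1\<close>, so the integer on the left is at most
    0.\<close>
  have right: "lcount (Inr j) \<le> k * rcount (Inr j)" for j
  proof (cases "j = w")
    case True
    then show ?thesis by (simp add: count_root card_m)
  next
    case False
    then obtain x where par: "is_parent G (Inr w) x (Inr j)"
      using ex_parent[of "Inr j"] by auto
    have "real (lcount (Inr j)) * (real a - t) - real (rcount (Inr j)) * real b < 0"
      using val[OF par] pos[OF par] by simp
    then have "real_of_int (int a * (int (lcount (Inr j)) - int k * int (rcount (Inr j))))
        < real (lcount (Inr j)) * t"
      by (simp add: b_eq algebra_simps)
    also have "\<dots> < 1"
      using lcount_le by (rule mult_t_less)
    finally have "int a * (int (lcount (Inr j)) - int k * int (rcount (Inr j))) \<le> 0"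
      by linarith
    then have "int (lcount (Inr j)) - int k * int (rcount (Inr j)) \<le> 0"
      using a_pos by (simp add: mult_le_0_iff)
    then have "int (lcount (Inr j)) \<le> int (k * rcount (Inr j))"
      by simp
    then show ?thesis by (simp only: of_nat_le_iff)
  qed
  \<comment> \<open>Each child has a left surplus of at least 1 over \<open>k * rcount\<close>,
    while \<open>Inr j\<close> itself, counted once in \<open>rcount\<close>, can absorb only
    \<open>k\<close>.\<close>
  have le: "card (children (Inr j)) \<le> k" for j
  proof -
    have "k * (\<Sum>c\<in>children (Inr j). rcount c) + card (children (Inr j))
        = (\<Sum>c\<in>children (Inr j). k * rcount c + 1)"
      by (simp only: sum.distrib sum_distrib_left) simp
    also have "\<dots> \<le> (\<Sum>c\<in>children (Inr j). lcount c)"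
      using child by (rule sum_mono)
    also have "\<dots> \<le> k * rcount (Inr j)"
      using right[of j] by (simp add: lcount_rec)
    also have "\<dots> = k * (\<Sum>c\<in>children (Inr j). rcount c) + k"
      by (simp add: rcount_rec)
    finally show ?thesis by simp
  qed
  \<comment> \<open>The numbers of children add up to \<open>k * CARD('n)\<close>, so every upper
    bound is attained.\<close>
  have "card (children (Inr j)) = k" for j
  proof (rule sum_mono_inv[where I = UNIV and f = "\<lambda>j. card (children (Inr j))" and g = "\<lambda>_. k"])
    show "(\<Sum>j\<in>UNIV. card (children (Inr j))) = (\<Sum>j\<in>(UNIV::'n set). k)"
      by (simp add: sum_card_children card_m)
  qed (auto simp: le)
  then show ?thesis
    unfolding G_def[symmetric] by (auto simp: fun_eq_iff degree_eq)
qed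

text \<open>The margins follow from the recursion for left counts, positivity on the tree edges from
  the bound on \<open>t\<close>, and extremality from \<open>zero_sums_imp_zero\<close>.\<close>

lemma tree_matrix_vertex:
  assumes "T \<in> ST k w"
  shows "tree_matrix w a t T \<in> polytope_vertices P" "auxiliary_graph (tree_matrix w a t T) = T"
proof -
  define X :: "real ^ 'n ^ 'm" where "X = tree_matrix w a t T"
  interpret bipartite_tree T w
    using assms by unfold_locales (simp add: ST_def)
  have card_children: "card (children (Inr j)) = k" for j
    using assms degree_eq[of j] by (simp add: ST_def split: if_splits)
  have lcount_Inl: "lcount (Inl i) > 0" for i
    by (simp add: lcount_rec)
  \<comment> \<open>As \<open>k \<ge> 1\<close>, each right vertex has a left child, so the entry
    \<open>lcount (Inr j) * t\<close> on its parent edge is positive.\<close>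
  have lcount_Inr: "lcount (Inr j) > 0" for j
  proof -
    have "(\<Sum>c\<in>children (Inr j). 1) \<le> (\<Sum>c\<in>children (Inr j). lcount c)"
      by (rule sum_mono) (auto simp: children_Inr Suc_le_eq lcount_Inl)
    then show ?thesis
      using k_pos by (simp add: card_children lcount_rec)
  qed
  have entry: "X $ i $ j =
     (if is_parent T (Inr w) (Inr j) (Inl i) then real a - real (lcount (Inl i)) * t
      else if is_parent T (Inr w) (Inl i) (Inr j) then real (lcount (Inr j)) * t else 0)" for i j
    by (simp add: X_def tree_matrix_def left_count_subtree)
  have up: "bip_entry X (Inl i) x = real a - real (lcount (Inl i)) * t"
    if "is_parent T (Inr w) x (Inl i)" for i x
    using that by (cases x) (simp_all add: entry)
  have down: "bip_entry X (Inr j) x = real (lcount (Inr j)) * t"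
    if "is_parent T (Inr w) x (Inr j)" for j x
    using that is_parent_asym[OF that] by (cases x) (simp_all add: entry)
  have pos_iff: "X $ i $ j > 0 \<longleftrightarrow> {Inl i, Inr j} \<in> gedges T"
    and nonneg: "X $ i $ j \<ge> 0"
    and supp: "X $ i $ j \<noteq> 0 \<Longrightarrow> {Inl i, Inr j} \<in> gedges T" for i j
  proof -
    have "real (lcount (Inl i)) * t < real a"
      using mult_t_less[OF lcount_le[of "Inl i"]] a_pos by linarith
    moreover have "0 < real (lcount (Inr j)) * t"
      using lcount_Inr[of j] t_pos by simp
    moreover have "{Inl i, Inr j} \<in> gedges T \<longleftrightarrow>
        is_parent T (Inr w) (Inr j) (Inl i) \<or> is_parent T (Inr w) (Inl i) (Inr j)"
      using edge_is_parent[of "Inl i" "Inr j"] is_parent_edge[of "Inl i" "Inr j"]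
        is_parent_edge[of "Inr j" "Inl i"] by (auto simp: insert_commute)
    ultimately show "X $ i $ j > 0 \<longleftrightarrow> {Inl i, Inr j} \<in> gedges T" "X $ i $ j \<ge> 0"
      "X $ i $ j \<noteq> 0 \<Longrightarrow> {Inl i, Inr j} \<in> gedges T"
      by (auto simp: entry)
  qed
  have adj: "{v, y} \<in> gedges T \<and> v \<noteq> y" if "bip_entry X v y \<noteq> 0" for v y
    using that supp by (cases v; cases y) (auto simp: insert_commute)
  have nbrs: "(\<Sum>y\<in>UNIV. bip_entry X v y)
      = (\<Sum>x | is_parent T (Inr w) x v. bip_entry X v x) + (\<Sum>c\<in>children v. bip_entry X v c)" for v
    by (rule sum_neighbours) (rule adj)
  have rows: "(\<Sum>j\<in>UNIV. X $ i $ j) = real a - t" for i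
  proof -
    obtain j where j: "is_parent T (Inr w) (Inr j) (Inl i)"
      using ex_parent_Inl by blast
    have "bip_entry X (Inl i) c = real (lcount c) * t" if "c \<in> children (Inl i)" for c
      using that down[of "Inl i"] by (cases c) (auto simp: children_def bip_entry_commute[of X "Inl i"])
    then have "(\<Sum>c\<in>children (Inl i). bip_entry X (Inl i) c)
        = (\<Sum>c\<in>children (Inl i). real (lcount c) * t)"
      by (rule sum.cong[OF refl])
    then have "(\<Sum>y\<in>UNIV. bip_entry X (Inl i) y)
        = real a - real (lcount (Inl i)) * t + (\<Sum>c\<in>children (Inl i). real (lcount c) * t)"
      using nbrs[of "Inl i"] by (simp only: parent_set[OF j]) (use up[OF j] in simp)
    \<comment> \<open>\<open>lcount (Inl i)\<close> counts \<open>Inl i\<close> besides the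
      descendants of its children; this 1 leaves the \<open>- t\<close>.\<close>
    also have "\<dots> = real a - t"
      by (simp add: lcount_rec algebra_simps sum_distrib_left)
    finally show ?thesis by simp
  qed
  have cols: "(\<Sum>i\<in>UNIV. X $ i $ j) = (if j = w then real b - real CARD('m) * t else real b)" for j
  proof -
    have par: "(\<Sum>x | is_parent T (Inr w) x (Inr j). bip_entry X (Inr j) x)
        = (if j = w then 0 else real (lcount (Inr j)) * t)"
    proof (cases "j = w")
      case True
      then show ?thesis by (simp add: not_is_parent_root)
    next
      case False
      then obtain x where x: "is_parent T (Inr w) x (Inr j)"
        using ex_parent[of "Inr j"] by auto
      then show ?thesis using False by (simp add: parent_set[OF x] down[OF x])
    qed
    have "bip_entry X (Inr j) c = real a - real (lcount c) * t" if "c \<in> children (Inr j)" for c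
      using that up[of "Inr j"] by (cases c) (auto simp: children_def bip_entry_commute[of X "Inr j"])
    then have "(\<Sum>c\<in>children (Inr j). bip_entry X (Inr j) c)
        = (\<Sum>c\<in>children (Inr j). real a - real (lcount c) * t)"
      by (rule sum.cong[OF refl])
    then have "(\<Sum>y\<in>UNIV. bip_entry X (Inr j) y)
        = (if j = w then 0 else real (lcount (Inr j)) * t)
          + (\<Sum>c\<in>children (Inr j). real a - real (lcount c) * t)"
      using nbrs[of "Inr j"] par by (simp only:)
    \<comment> \<open>The \<open>k\<close> children contribute \<open>k * a = b\<close>. The parent
      edge cancels the \<open>t\<close> term except at the root, where the left count is
      \<open>CARD('m)\<close>.\<close>
    also have "(\<Sum>c\<in>children (Inr j). real a - real (lcount c) * t)
        = real b - real (lcount (Inr j)) * t"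
      by (simp add: sum_subtractf card_children b_eq lcount_rec sum_distrib_right)
    finally show ?thesis
      by (simp add: count_root)
  qed
  have "X \<in> P"
    using nonneg rows cols
    by (simp add: P_def mem_transportation_polytope row_sums_def col_sums_def)
  moreover have "D = 0" if "zero_sums D" "\<forall>i j. D $ i $ j \<noteq> 0 \<longrightarrow> X $ i $ j > 0" for D
    using that pos_iff by (intro zero_sums_imp_zero) auto
  ultimately show "tree_matrix w a t T \<in> polytope_vertices P"
    unfolding X_def[symmetric] P_def polytope_vertex_iff by blast
  have "gedges (auxiliary_graph X) = gedges T"
  proof (rule set_eqI, rule iffI)
    fix e assume "e \<in> gedges (auxiliary_graph X)"
    then show "e \<in> gedges T"
      by (auto simp: auxiliary_graph_def pos_iff)
  next
    fix e assume e: "e \<in> gedges T"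
    then obtain i j where "e = {Inl i, Inr j}"
      by (rule edgeE)
    then show "e \<in> gedges (auxiliary_graph X)"
      using e by (simp add: pos_iff)
  qed
  then show "auxiliary_graph (tree_matrix w a t T) = T"
    unfolding X_def[symmetric] using verts by (intro ugraph.equality) simp_all
qed

lemma vertices_bij_trees:
  "auxiliary_graph ` polytope_vertices P = ST k w
    \<and> bij_betw auxiliary_graph (polytope_vertices P) (ST k w)
    \<and> (\<forall>T\<in>ST k w. tree_matrix w a t T \<in> polytope_vertices P
         \<and> auxiliary_graph (tree_matrix w a t T) = T)"
proof -
  have "auxiliary_graph M \<in> ST k w" if "M \<in> polytope_vertices P" for M
    using that auxiliary_graph_spanning_tree right_degree_auxiliary_graph by (simp add: ST_def)
  then have "auxiliary_graph ` polytope_vertices P = ST k w"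
    using tree_matrix_vertex by force
  moreover have "inj_on auxiliary_graph (polytope_vertices P)"
    unfolding P_def by (intro inj_onI vertex_eq_if_auxiliary_graph_eq)
  ultimately show ?thesis
    using tree_matrix_vertex by (simp add: bij_betw_def)
qed

end

theorem theorem6p1:
  fixes k m n a b :: nat
    and w :: "'n::finite"
    and t :: real
    and V :: "(real ^ 'n ^ 'm::finite) set"
  assumes "m = CARD('m)" and "n = CARD('n)"
    and "k \<ge> 1" and "n \<ge> 1" and "m = k * n"
    and "a \<ge> 1" and "b \<ge> 1" and "m * a = n * b"
    and "0 < t" and "t < 1 / real m"
  defines "V \<equiv> polytope_vertices (transportation_polytope (row_sums a t) (col_sums w m b t))"
  shows "auxiliary_graph ` V = ST k w
    \<and> bij_betw auxiliary_graph V (ST k w)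
    \<and> (\<forall>T\<in>ST k w. tree_matrix w a t T \<in> V \<and> auxiliary_graph (tree_matrix w a t T) = T)"
proof -
  \<comment> \<open>Clearing the denominator uses \<open>m = k * n > 0\<close>.\<close>
  have "real m * t < 1"
    using assms(3,4,5,10) by (simp add: field_simps)
  then interpret perturbed_transportation k a b w t
      "transportation_polytope (row_sums a t) (col_sums w m b t) :: (real ^ 'n ^ 'm) set"
    using assms by unfold_locales auto
  show ?thesis
    unfolding V_def by (rule vertices_bij_trees)
qed

end
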